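(* Fix $h,c,\mu,\gamma>0$ and $r>1$. For $\lambda>0$ and $s\in\mathbb{Z}_+$, let $\mathbb{E}W_\lambda(s)$ be the expected steady-state waiting time (time in queue) in the $M/M/s+M$ queue with arrival rate $\lambda$, service rate $\mu$ and exponential patience times of mean $1/\gamma$, and consider the problem $$\min_{s\in\mathbb{Z}_+}\;\Pi_\lambda(s):=h\,\lambda\left[\mathbb{E}W_\lambda(s)\right]^r+c\,s,$$ with optimal value $\Pi_\lambda^\star$. Let $$\sigma^\star=\max\left\{1-\left(\frac{c\,\gamma^r}{h\,r\,\mu}\right)^{\frac{1}{r-1}},\,0\right\}<1.$$ Then, as $\lambda\to\infty$, any staffing prescription $\bar s_\lambda\in\mathbb{Z}_+$ of the form $\bar s_\lambda=\sigma^\star\frac{\lambda}{\mu}+o(\sqrt{\lambda})$ is $o(1)$-optimal, i.e. $\lim_{\lambda\to\infty}\left(\Pi_\lambda(\bar s_\lambda)-\Pi_\lambda^\star\right)=0$.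
   Context: $M/M/s+M$ queue: Poisson arrivals of rate $\lambda$, $s$ identical servers with exponential service times of mean $1/\mu$, and each customer has an independent exponential patience time of mean $1/\gamma$; a customer whose patience expires while waiting (before beginning service) leaves the system. Equivalently the number in system is a birth-death process with birth rate $\lambda$ and death rate $\min(k,s)\mu+\max(k-s,0)\gamma$ in state $k$; the queue length is $\max(k-s,0)$. The expected waiting time is over all arriving customers (served or abandoning), so by Little's law $\mathbb{E}W_\lambda(s)=\mathbb{E}Q_\lambda(s)/\lambda$, where $\mathbb{E}Q_\lambda(s)$ is the expected steady-state queue length.
   Formalization: When cγ^r > hrμ (so σ* = 0) the prescription is additionally required to be 0 for all large λ; otherwise the claim fails, e.g. h = μ = γ = 1, r = 2, c = 4 and s̄ = ⌊λ^{1/4}⌋ give Π(s̄) − Π* ≥ 2s̄ → ∞. *)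

theory Defs
  imports "HOL-Probability.Probability" "HOL-Library.Landau_Symbols"
begin

text \<open>Stationary laws of a birth-death process on the natural numbers, given by the
  global balance equations (rate out of a state = rate into it); there are no deaths in state 0.\<close>

definition bd_stationary :: "(nat \<Rightarrow> real) \<Rightarrow> (nat \<Rightarrow> real) \<Rightarrow> nat pmf \<Rightarrow> bool" where
  "bd_stationary birth death p \<longleftrightarrow>
     birth 0 * pmf p 0 = death 1 * pmf p 1 \<and>
     (\<forall>k\<ge>1. (birth k + death k) * pmf p k =
             birth (k - 1) * pmf p (k - 1) + death (k + 1) * pmf p (k + 1))"

text \<open>The subtraction \<open>k - s\<close> below is truncated, so it is the queue length when
  \<open>k\<close> customers are in the system.\<close>

definition mmsm_death :: "real \<Rightarrow> real \<Rightarrow> nat \<Rightarrow> nat \<Rightarrow> real" where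
  "mmsm_death \<mu> \<gamma> s k = real (min k s) * \<mu> + real (k - s) * \<gamma>"

text \<open>For positive rates the death rates grow linearly while the birth rate is constant, hence
  there is exactly one stationary law and the queue length has a finite mean under it.\<close>

definition mmsm_steady_state :: "real \<Rightarrow> real \<Rightarrow> real \<Rightarrow> nat \<Rightarrow> nat pmf" where
  "mmsm_steady_state lam \<mu> \<gamma> s = (THE p. bd_stationary (\<lambda>_. lam) (mmsm_death \<mu> \<gamma> s) p)"

definition mmsm_EQ :: "real \<Rightarrow> real \<Rightarrow> real \<Rightarrow> nat \<Rightarrow> real" where
  "mmsm_EQ lam \<mu> \<gamma> s = measure_pmf.expectation (mmsm_steady_state lam \<mu> \<gamma> s) (\<lambda>k. real (k - s))"

text \<open>Mean time in queue over all arriving customers, served or abandoning (Little's law).\<close>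

definition mmsm_EW :: "real \<Rightarrow> real \<Rightarrow> real \<Rightarrow> nat \<Rightarrow> real" where
  "mmsm_EW lam \<mu> \<gamma> s = mmsm_EQ lam \<mu> \<gamma> s / lam"

definition staffing_cost ::
  "real \<Rightarrow> real \<Rightarrow> real \<Rightarrow> real \<Rightarrow> real \<Rightarrow> real \<Rightarrow> nat \<Rightarrow> real" where
  "staffing_cost h c \<mu> \<gamma> r lam s = h * lam * mmsm_EW lam \<mu> \<gamma> s powr r + c * real s"

text \<open>The cost is nonnegative and at least \<open>c * real s\<close>, so the infimum is a minimum.\<close>

definition optimal_cost :: "real \<Rightarrow> real \<Rightarrow> real \<Rightarrow> real \<Rightarrow> real \<Rightarrow> real \<Rightarrow> real" where
  "optimal_cost h c \<mu> \<gamma> r lam = (INF s. staffing_cost h c \<mu> \<gamma> r lam s)"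

text \<open>If \<open>c * \<gamma> powr r > h * r * \<mu>\<close>, the maximum is 0 and staffing is not worthwhile:
  each server adds at least \<open>c - h * r * \<mu> / \<gamma> powr r > 0\<close> to the cost of having none.
  A prescription is then asymptotically optimal only if it is eventually exactly 0, and no
  deviation of order \<open>o(sqrt lam)\<close> can be tolerated.\<close>

definition sigma_star :: "real \<Rightarrow> real \<Rightarrow> real \<Rightarrow> real \<Rightarrow> real \<Rightarrow> real" where
  "sigma_star h c \<mu> \<gamma> r = max (1 - (c * \<gamma> powr r / (h * r * \<mu>)) powr (1 / (r - 1))) 0"

end

theory Submission imports Defs "HOL-Real_Asymp.Real_Asymp" begin

text \<open>Write \<open>a = (1 - \<sigma>) / \<gamma>\<close> for the fluid waiting time at capacity fraction
  \<open>\<sigma> = sigma_star h c \<mu> \<gamma> r\<close>. In the steady state the flow of arrivals equals the flow of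
  departures, by service or by abandonment, and this gives the exact formula \<open>mmsm_EW_eq\<close>:
  the mean wait is the fluid value \<open>(1 - \<mu> * s / lam) / \<gamma>\<close> plus a nonnegative correction
  proportional to the mean number of idle servers divided by \<open>lam\<close>.

  Both halves of the proof compare the cost with the fluid optimum
  \<open>lam * (h * a powr r + c / \<mu> * \<sigma>)\<close>, and both use that \<open>\<sigma>\<close> satisfies the first-order
  condition of the convex fluid problem (\<open>sigma_star_optimality\<close>).

  Lower bound, for each \<open>s\<close> (\<open>staffing_cost_ge_fluid_cost\<close>): replace \<open>x powr r\<close> by its tangent
  at \<open>a\<close> and drop the idle-server correction. What remains is affine in \<open>s\<close> and, by the
  first-order condition, at least the fluid optimum.

  Upper bound along the prescription (\<open>staffing_cost_minus_fluid_cost_tendsto_0\<close>): at an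
  interior or boundary stationary point the linear terms cancel, so the excess cost is quadratic
  in the deviation of the wait from \<open>a\<close>. That deviation is \<open>o(1 / sqrt lam)\<close>, and the factor
  \<open>lam\<close> turns its square into \<open>o(1)\<close>. The idle-server correction enters the cost linearly with
  a bounded factor, so it suffices that the mean number of idle servers vanishes. It does because
  \<open>\<sigma> < 1\<close>: births dominate deaths in a window of length proportional to \<open>lam\<close> above state \<open>s\<close>,
  so the stationary mass below \<open>s\<close> is exponentially small in \<open>lam\<close>
  (\<open>mmsm_idle_tendsto_0\<close>). When staffing is strictly unprofitable the prescription is
  eventually 0, there are no servers to be idle, and the cost is exactly the fluid optimum.\<close>

section \<open>Stationary laws of birth-death processes\<close>

text \<open>Global balance telescopes: the balance of state \<open>k\<close> minus the cut equation between
  \<open>k - 1\<close> and \<open>k\<close> is the cut equation between \<open>k\<close> and \<open>k + 1\<close>.\<close>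

lemma bd_stationary_iff_detailed_balance:
  "bd_stationary birth death p \<longleftrightarrow> (\<forall>k. birth k * pmf p k = death (Suc k) * pmf p (Suc k))"
proof
  assume stat: "bd_stationary birth death p"
  have "birth k * pmf p k = death (Suc k) * pmf p (Suc k)" for k
  proof (induction k)
    case 0
    then show ?case using stat by (simp add: bd_stationary_def)
  next
    case (Suc k)
    have "(birth (Suc k) + death (Suc k)) * pmf p (Suc k)
        = birth k * pmf p k + death (Suc (Suc k)) * pmf p (Suc (Suc k))"
      using stat unfolding bd_stationary_def by (metis Suc_eq_plus1 add_diff_cancel_right' le_add2)
    with Suc.IH show ?case by (simp add: algebra_simps)
  qed
  then show "\<forall>k. birth k * pmf p k = death (Suc k) * pmf p (Suc k)" by blast
next
  assume "\<forall>k. birth k * pmf p k = death (Suc k) * pmf p (Suc k)"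
  then have *: "birth k * pmf p k = death (Suc k) * pmf p (Suc k)" for k by blast
  have "(birth k + death k) * pmf p k = birth (k - 1) * pmf p (k - 1) + death (k + 1) * pmf p (k + 1)"
    if "k \<ge> 1" for k
    using *[of k] *[of "k - 1"] that by (simp add: algebra_simps)
  moreover have "birth 0 * pmf p 0 = death 1 * pmf p 1" using *[of 0] by simp
  ultimately show "bd_stationary birth death p" unfolding bd_stationary_def by blast
qed

text \<open>The unnormalised stationary law, normalised instead to the value 1 in state 0.\<close>
definition bd_weight :: "(nat \<Rightarrow> real) \<Rightarrow> (nat \<Rightarrow> real) \<Rightarrow> nat \<Rightarrow> real" where
  "bd_weight birth death k = (\<Prod>j<k. birth j / death (Suc j))"

lemma bd_stationary_iff_weight:
  assumes "\<And>k. death (Suc k) > 0"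
  shows "bd_stationary birth death p \<longleftrightarrow> (\<forall>k. pmf p k = pmf p 0 * bd_weight birth death k)"
proof
  assume "bd_stationary birth death p"
  then have "pmf p (Suc k) = pmf p k * (birth k / death (Suc k))" for k
    using assms[of k] by (simp add: bd_stationary_iff_detailed_balance field_simps)
  then have "pmf p k = pmf p 0 * bd_weight birth death k" for k
    by (induction k) (simp_all add: bd_weight_def)
  then show "\<forall>k. pmf p k = pmf p 0 * bd_weight birth death k" by blast
next
  assume w: "\<forall>k. pmf p k = pmf p 0 * bd_weight birth death k"
  have "birth k * pmf p k = death (Suc k) * pmf p (Suc k)" for k
  proof -
    have "pmf p (Suc k) = pmf p k * (birth k / death (Suc k))"
      using w[rule_format, of k] w[rule_format, of "Suc k"] by (simp add: bd_weight_def)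
    then show ?thesis using assms[of k] by (simp add: field_simps)
  qed
  then show "bd_stationary birth death p" by (simp add: bd_stationary_iff_detailed_balance)
qed

lemma nat_pmf_expectation_sums:
  assumes "summable (\<lambda>k. pmf p k * \<bar>f k\<bar>)"
  shows "(\<lambda>k. pmf p k * f k) sums measure_pmf.expectation p f"
proof -
  have "integrable (count_space UNIV) (\<lambda>k. pmf p k * f k)"
    using assms by (simp add: integrable_count_space_nat_iff abs_mult)
  then have "(\<lambda>k. pmf p k * f k) sums (\<integral>k. pmf p k * f k \<partial>count_space UNIV)"
    by (rule sums_integral_count_space_nat)
  also have "(\<integral>k. pmf p k * f k \<partial>count_space UNIV) = measure_pmf.expectation p f"
    unfolding measure_pmf_eq_density by (subst integral_density) auto
  finally show ?thesis .
qed

lemma nat_pmf_sums_1: "(pmf p :: nat \<Rightarrow> real) sums 1"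
proof -
  have "integrable (count_space UNIV) (pmf p)" by (simp add: integrable_pmf)
  then have "pmf p sums (\<integral>k. pmf p k \<partial>count_space UNIV)"
    by (rule sums_integral_count_space_nat)
  then show ?thesis by (simp add: integral_pmf)
qed

text \<open>By \<open>bd_stationary_iff_weight\<close> a stationary law is determined by its mass in state 0,
  and summability of the weights is what allows this mass to be fixed by normalisation.\<close>
lemma ex1_bd_stationary:
  assumes birth: "\<And>k. birth k \<ge> 0" and death: "\<And>k. death (Suc k) > 0"
    and summ: "summable (bd_weight birth death)"
  shows "\<exists>!p. bd_stationary birth death p"
proof (rule ex_ex1I)
  let ?w = "bd_weight birth death"
  note weight_iff = bd_stationary_iff_weight[where death = death, OF death]
  have nonneg: "?w k \<ge> 0" for k
    unfolding bd_weight_def using birth death by (intro prod_nonneg ballI divide_nonneg_pos) auto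
  have w0: "?w 0 = 1" by (simp add: bd_weight_def)
  have pos: "suminf ?w > 0"
    using nonneg w0 summ by (intro suminf_pos2[where i = 0]) auto
  let ?f = "\<lambda>k. ?w k / suminf ?w"
  have f_nonneg: "?f k \<ge> 0" for k using nonneg pos by simp
  have "?f sums 1" using sums_divide[OF summable_sums[OF summ], of "suminf ?w"] pos by simp
  then have "(\<Sum>k. ennreal (?f k)) = ennreal 1" by (intro suminf_ennreal_eq f_nonneg)
  then have "(\<integral>\<^sup>+k. ennreal (?f k) \<partial>count_space UNIV) = 1"
    by (simp add: nn_integral_count_space_nat)
  then have pmf_f: "pmf (embed_pmf ?f) k = ?f k" for k
    using f_nonneg by (simp add: pmf_embed_pmf)
  show "\<exists>p. bd_stationary birth death p"
    by (rule exI[of _ "embed_pmf ?f"]) (simp only: weight_iff pmf_f w0, simp)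
  show "p = q" if "bd_stationary birth death p" "bd_stationary birth death q" for p q
  proof -
    have norm: "pmf p' 0 = 1 / suminf ?w" if "bd_stationary birth death p'" for p'
    proof -
      have *: "pmf p' = (\<lambda>k. pmf p' 0 * ?w k)"
        using that unfolding weight_iff by blast
      have "(\<lambda>k. pmf p' 0 * ?w k) sums (pmf p' 0 * suminf ?w)"
        by (intro sums_mult summable_sums summ)
      then have "pmf p' sums (pmf p' 0 * suminf ?w)"
        using * by metis
      with nat_pmf_sums_1 have "pmf p' 0 * suminf ?w = 1" by (rule sums_unique2[symmetric])
      with pos show ?thesis by (simp add: field_simps)
    qed
    have "pmf p k = pmf q k" for k
      using that norm[of p] norm[of q] unfolding weight_iff by metis
    then show "p = q" by (intro pmf_eqI)
  qed
qed

section \<open>Steady state of the queue with abandonment\<close>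

lemma mmsm_death_pos:
  assumes "\<mu> > 0" "\<gamma> > 0"
  shows "mmsm_death \<mu> \<gamma> s (Suc k) > 0"
proof (cases "s = 0")
  case True
  then show ?thesis using assms by (simp add: mmsm_death_def)
next
  case False
  then have "real (min (Suc k) s) * \<mu> > 0" using assms by simp
  moreover have "real (Suc k - s) * \<gamma> \<ge> 0" using assms by simp
  ultimately show ?thesis unfolding mmsm_death_def by (rule add_pos_nonneg)
qed

text \<open>The definite description in \<open>mmsm_steady_state\<close> denotes something because the stationary
  law exists uniquely: once the queue is longer than \<open>2 * lam / \<gamma>\<close>, abandonment alone outpaces
  arrivals by a factor of 2, and the weights decrease geometrically.\<close>
lemma bd_stationary_mmsm_steady_state:
  assumes "lam > 0" "\<mu> > 0" "\<gamma> > 0"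
  shows "bd_stationary (\<lambda>_. lam) (mmsm_death \<mu> \<gamma> s) (mmsm_steady_state lam \<mu> \<gamma> s)"
proof -
  let ?d = "mmsm_death \<mu> \<gamma> s" and ?w = "bd_weight (\<lambda>_. lam) (mmsm_death \<mu> \<gamma> s)"
  note dpos = mmsm_death_pos[OF assms(2,3), of s]
  obtain N :: nat where N: "real N \<ge> real s + 2 * lam / \<gamma>" using real_arch_simple by blast
  have "summable ?w"
  proof (rule summable_ratio_test[where c = "1/2" and N = N])
    fix k assume "k \<ge> N"
    have "2 * lam / \<gamma> \<ge> 0" using assms by simp
    then have "real s \<le> real N" using N by linarith
    then have "s \<le> Suc k" using \<open>k \<ge> N\<close> by linarith
    then have "real (Suc k - s) \<ge> 2 * lam / \<gamma>" using N \<open>k \<ge> N\<close> by (simp add: of_nat_diff)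
    then have "real (Suc k - s) * \<gamma> \<ge> 2 * lam" using assms by (simp only: pos_divide_le_eq)
    moreover have "real (min (Suc k) s) * \<mu> \<ge> 0" using assms by simp
    ultimately have "?d (Suc k) \<ge> 2 * lam" unfolding mmsm_death_def by linarith
    then have "lam / ?d (Suc k) \<le> 1/2" using dpos[of k] by (simp add: field_simps)
    then have "\<bar>?w k\<bar> * (lam / ?d (Suc k)) \<le> \<bar>?w k\<bar> * (1/2)" by (intro mult_left_mono) auto
    then show "norm (?w (Suc k)) \<le> 1/2 * norm (?w k)"
      using dpos[of k] assms by (simp add: bd_weight_def abs_mult)
  qed simp
  with ex1_bd_stationary[of "\<lambda>_. lam" ?d] dpos assms
  have "\<exists>!p. bd_stationary (\<lambda>_. lam) ?d p" by simp
  then show ?thesis unfolding mmsm_steady_state_def by (rule theI')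
qed

lemma mmsm_detailed_balance:
  assumes "lam > 0" "\<mu> > 0" "\<gamma> > 0"
  shows "lam * pmf (mmsm_steady_state lam \<mu> \<gamma> s) k
    = mmsm_death \<mu> \<gamma> s (Suc k) * pmf (mmsm_steady_state lam \<mu> \<gamma> s) (Suc k)"
  using bd_stationary_mmsm_steady_state[OF assms, of s]
  by (simp add: bd_stationary_iff_detailed_balance)

definition mmsm_idle :: "real \<Rightarrow> real \<Rightarrow> real \<Rightarrow> nat \<Rightarrow> real" where
  "mmsm_idle lam \<mu> \<gamma> s = measure_pmf.expectation (mmsm_steady_state lam \<mu> \<gamma> s) (\<lambda>k. real (s - k))"

lemma mmsm_idle_nonneg: "mmsm_idle lam \<mu> \<gamma> s \<ge> 0"
  unfolding mmsm_idle_def by (rule Bochner_Integration.integral_nonneg) simp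

lemma mmsm_idle_0 [simp]: "mmsm_idle lam \<mu> \<gamma> 0 = 0"
  by (simp add: mmsm_idle_def)

lemma mmsm_EW_nonneg: "lam \<ge> 0 \<Longrightarrow> mmsm_EW lam \<mu> \<gamma> s \<ge> 0"
  unfolding mmsm_EW_def mmsm_EQ_def
  by (intro divide_nonneg_nonneg Bochner_Integration.integral_nonneg) auto

text \<open>Summing the cut equations over all states equates the arrival rate with the mean death rate.
  The latter splits into service by the busy servers and abandonment from the queue. Convergence
  of this sum also shows that the mean queue length is finite.\<close>
lemma mmsm_flow_balance:
  assumes "lam > 0" "\<mu> > 0" "\<gamma> > 0"
  shows "lam = \<mu> * (real s - mmsm_idle lam \<mu> \<gamma> s) + \<gamma> * mmsm_EQ lam \<mu> \<gamma> s"
proof -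
  let ?d = "mmsm_death \<mu> \<gamma> s" and ?p = "mmsm_steady_state lam \<mu> \<gamma> s"
  have "(\<lambda>k. lam * pmf ?p k) sums (lam * 1)" by (intro sums_mult nat_pmf_sums_1)
  then have "(\<lambda>k. ?d (Suc k) * pmf ?p (Suc k)) sums lam"
    by (simp add: mmsm_detailed_balance assms)
  then have death: "(\<lambda>k. ?d k * pmf ?p k) sums lam"
    using sums_Suc_iff[of "\<lambda>k. ?d k * pmf ?p k" lam] by (simp add: mmsm_death_def)
  have idle: "(\<lambda>k. pmf ?p k * real (s - k)) sums mmsm_idle lam \<mu> \<gamma> s"
    unfolding mmsm_idle_def
    by (intro nat_pmf_expectation_sums summable_finite[of "{..<s}"]) auto
  \<comment> \<open>Without summability the expectation in \<open>mmsm_EQ\<close> would be the default value 0 of the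
    integral.\<close>
  have "summable (\<lambda>k. pmf ?p k * real (k - s))"
  proof (rule summable_comparison_test')
    show "summable (\<lambda>k. ?d k * pmf ?p k / \<gamma>)" using death by (intro summable_divide) (rule sums_summable)
    show "norm (pmf ?p k * real (k - s)) \<le> ?d k * pmf ?p k / \<gamma>" if "k \<ge> 0" for k
    proof -
      have "real (k - s) * \<gamma> \<le> ?d k" using assms by (simp add: mmsm_death_def)
      then have "real (k - s) * \<gamma> * pmf ?p k \<le> ?d k * pmf ?p k" by (intro mult_right_mono) auto
      then show ?thesis using assms by (simp add: field_simps)
    qed
  qed
  then have queue: "(\<lambda>k. pmf ?p k * real (k - s)) sums mmsm_EQ lam \<mu> \<gamma> s"
    unfolding mmsm_EQ_def by (intro nat_pmf_expectation_sums) simp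
  have "real (min k s) = real s - real (s - k)" for k by (cases "k \<le> s") (simp_all add: of_nat_diff)
  then have d_eq: "?d k = \<mu> * (real s - real (s - k)) + \<gamma> * real (k - s)" for k
    unfolding mmsm_death_def by (simp only: mult.commute)
  have eq: "?d k * pmf ?p k = \<mu> * (real s * pmf ?p k - pmf ?p k * real (s - k))
      + \<gamma> * (pmf ?p k * real (k - s))" for k
    unfolding d_eq by (simp add: algebra_simps)
  have "(\<lambda>k. ?d k * pmf ?p k) sums (\<mu> * (real s * 1 - mmsm_idle lam \<mu> \<gamma> s) + \<gamma> * mmsm_EQ lam \<mu> \<gamma> s)"
    unfolding eq by (intro sums_add sums_mult sums_diff nat_pmf_sums_1 idle queue)
  with death show ?thesis using sums_unique2 by fastforce
qed

text \<open>The first summand is the wait of the fluid model, which may be negative if \<open>s\<close> is large.\<close>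
lemma mmsm_EW_eq:
  assumes "lam > 0" "\<mu> > 0" "\<gamma> > 0"
  shows "mmsm_EW lam \<mu> \<gamma> s = (1 - \<mu> * real s / lam) / \<gamma> + \<mu> / (\<gamma> * lam) * mmsm_idle lam \<mu> \<gamma> s"
proof -
  have EQ: "mmsm_EQ lam \<mu> \<gamma> s = (lam - \<mu> * (real s - mmsm_idle lam \<mu> \<gamma> s)) / \<gamma>"
    using mmsm_flow_balance[OF assms, of s] assms by (simp add: eq_divide_eq mult.commute)
  show ?thesis unfolding mmsm_EW_def EQ using assms by (simp add: field_simps)
qed

section \<open>Idle servers in an overloaded system\<close>

text \<open>By the cut equations, the mass changes by the factor \<open>death (Suc k) / lam \<le> \<rho>\<close> in each step
  down from \<open>m\<close>.\<close>
lemma pmf_le_power_if_birth_dominates: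
  assumes lam: "lam > 0" and rho: "0 \<le> \<rho>"
    and balance: "\<And>k. lam * pmf p k = death (Suc k) * pmf p (Suc k)"
    and small: "\<And>k. k < m \<Longrightarrow> death (Suc k) \<le> \<rho> * lam"
    and "j \<le> m"
  shows "pmf p (m - j) \<le> \<rho> ^ j"
  using \<open>j \<le> m\<close>
proof (induction j)
  case 0
  then show ?case by (simp add: pmf_le_1)
next
  case (Suc j)
  have S: "Suc (m - Suc j) = m - j" using Suc.prems by simp
  have "lam * pmf p (m - Suc j) = death (m - j) * pmf p (m - j)"
    using balance[of "m - Suc j"] by (simp only: S)
  also have "\<dots> \<le> (\<rho> * lam) * pmf p (m - j)"
    using small[of "m - Suc j"] Suc.prems S by (intro mult_right_mono) auto
  finally have "pmf p (m - Suc j) \<le> \<rho> * pmf p (m - j)" using lam by simp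
  also have "\<dots> \<le> \<rho> * \<rho> ^ j" using rho Suc by (intro mult_left_mono) auto
  finally show ?case by simp
qed

text \<open>The geometric decay is started at level \<open>s + n\<close>, where the death rate is still at most
  \<open>\<rho> * lam\<close>; every state with an idle server lies at least \<open>n\<close> steps below. The bound is crude
  in \<open>s\<close>, both for the number of such states and for the idle servers in each.\<close>
lemma mmsm_idle_le:
  assumes "lam > 0" "\<mu> > 0" "\<gamma> > 0" and rho: "0 \<le> \<rho>" "\<rho> \<le> 1"
    and load: "\<mu> * real s + \<gamma> * real n \<le> \<rho> * lam"
  shows "mmsm_idle lam \<mu> \<gamma> s \<le> (real s)\<^sup>2 * \<rho> ^ n"
proof -
  let ?p = "mmsm_steady_state lam \<mu> \<gamma> s"
  have death: "mmsm_death \<mu> \<gamma> s (Suc k) \<le> \<rho> * lam" if "k < s + n" for k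
  proof -
    have "real (min (Suc k) s) * \<mu> \<le> real s * \<mu>" "real (Suc k - s) * \<gamma> \<le> real n * \<gamma>"
      using that assms by (auto intro!: mult_right_mono)
    then show ?thesis using load unfolding mmsm_death_def by (simp add: mult.commute)
  qed
  have small: "pmf ?p k \<le> \<rho> ^ n" if "k < s" for k
  proof -
    have "pmf ?p (s + n - (s + n - k)) \<le> \<rho> ^ (s + n - k)"
      by (rule pmf_le_power_if_birth_dominates[where lam = lam and death = "mmsm_death \<mu> \<gamma> s"])
         (use assms death mmsm_detailed_balance in auto)
    also have "\<dots> \<le> \<rho> ^ n" using rho that by (intro power_decreasing) auto
    finally show ?thesis using that by simp
  qed
  have "mmsm_idle lam \<mu> \<gamma> s = (\<Sum>k<s. real (s - k) * pmf ?p k)"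
    unfolding mmsm_idle_def by (intro integral_measure_pmf_real) auto
  also have "\<dots> \<le> (\<Sum>k<s. real s * \<rho> ^ n)"
    using small by (intro sum_mono mult_mono) auto
  also have "\<dots> = (real s)\<^sup>2 * \<rho> ^ n" by (simp add: power2_eq_square)
  finally show ?thesis .
qed

section \<open>Comparison with the fluid cost\<close>

lemma powr_ge_tangent:
  fixes r x y :: real
  assumes "r \<ge> 1" "x > 0" "y \<ge> 0"
  shows "y powr r \<ge> x powr r + r * x powr (r - 1) * (y - x)"
proof (cases "y = 0")
  case True
  have "x powr (r - 1) * x = x powr r" using assms by (simp add: powr_mult_base mult.commute)
  then have "x powr r + r * x powr (r - 1) * (0 - x) = (1 - r) * x powr r" by (simp add: algebra_simps)
  also have "\<dots> \<le> 0" using assms by (intro mult_nonpos_nonneg) auto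
  finally show ?thesis using True by simp
next
  case False
  have "y powr r - x powr r \<ge> (r * x powr (r - 1)) * (y - x)"
    by (rule convex_on_imp_above_tangent[of "{0<..}"])
       (use assms False in \<open>auto intro!: powr_convex derivative_eq_intros
          simp: interior_open powr_diff field_simps\<close>)
  then show ?thesis by simp
qed


text \<open>The load \<open>\<sigma>\<close> of the servers stays below 1, which leaves room for a window above \<open>s\<close> of
  length proportional to \<open>lam\<close> in which the death rate is at most \<open>\<rho> * lam\<close> for some \<open>\<rho> < 1\<close>. The bound of
  \<open>mmsm_idle_le\<close> is then quadratic in \<open>lam\<close> times exponentially small.\<close>
lemma mmsm_idle_tendsto_0:
  assumes "\<mu> > 0" "\<gamma> > 0" "0 \<le> \<sigma>" "\<sigma> < 1"
    and load: "((\<lambda>lam. \<mu> * real (s lam) / lam) \<longlongrightarrow> \<sigma>) at_top"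
  shows "((\<lambda>lam. mmsm_idle lam \<mu> \<gamma> (s lam)) \<longlongrightarrow> 0) at_top"
proof (rule tendsto_sandwich[OF _ _ tendsto_const])
  \<comment> \<open>Half of the slack \<open>1 - \<sigma>\<close> absorbs the convergence of the load, a quarter pays for the
    abandonments in the window, and the last quarter keeps \<open>\<rho>\<close> below 1.\<close>
  define \<rho> where "\<rho> = (3 + \<sigma>) / 4"
  define b where "b = (1 - \<sigma>) / (4 * \<gamma>)"
  have rho: "0 < \<rho>" "\<rho> < 1" and b: "b > 0" using assms by (simp_all add: \<rho>_def b_def)
  have "\<forall>\<^sub>F lam in at_top. \<mu> * real (s lam) / lam < (1 + \<sigma>) / 2"
    by (rule order_tendstoD(2)[OF load]) (use assms in simp)
  then show "\<forall>\<^sub>F lam in at_top. mmsm_idle lam \<mu> \<gamma> (s lam) \<le> (lam / \<mu>)\<^sup>2 * \<rho> powr (b * lam - 1)"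
    using eventually_gt_at_top[of 0]
  proof eventually_elim
    case (elim lam)
    define n where "n = nat \<lfloor>b * lam\<rfloor>"
    have "b * lam \<ge> 0" using b elim by simp
    then have n: "real n \<le> b * lam" "b * lam - 1 \<le> real n" by (simp_all add: n_def)
    have s: "\<mu> * real (s lam) \<le> (1 + \<sigma>) / 2 * lam" using elim by (simp add: pos_divide_less_eq)
    have "\<gamma> * real n \<le> \<gamma> * (b * lam)" using n assms by (intro mult_left_mono) auto
    also have "\<dots> = (1 - \<sigma>) / 4 * lam" using assms by (simp add: b_def)
    finally have "\<mu> * real (s lam) + \<gamma> * real n \<le> \<rho> * lam"
      using s by (simp add: \<rho>_def field_simps)
    then have "mmsm_idle lam \<mu> \<gamma> (s lam) \<le> (real (s lam))\<^sup>2 * \<rho> ^ n"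
      using rho assms elim by (intro mmsm_idle_le) auto
    also have "\<dots> \<le> (lam / \<mu>)\<^sup>2 * \<rho> powr (b * lam - 1)"
    proof (intro mult_mono power_mono)
      have "(1 + \<sigma>) / 2 * lam \<le> 1 * lam" using assms elim by (intro mult_right_mono) auto
      then show "real (s lam) \<le> lam / \<mu>" using s assms by (simp add: field_simps)
      have "\<rho> ^ n = \<rho> powr real n" using rho by (simp add: powr_realpow)
      also have "\<dots> \<le> \<rho> powr (b * lam - 1)" using rho n by (intro powr_mono') auto
      finally show "\<rho> ^ n \<le> \<rho> powr (b * lam - 1)" .
    qed (use rho in auto)
    finally show ?case .
  qed
  define q where "q = - ln \<rho>"
  have "q > 0" using rho by (simp add: q_def)
  then have "((\<lambda>lam. (lam / \<mu>)\<^sup>2 * exp (- (q * (b * lam - 1)))) \<longlongrightarrow> 0) at_top"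
    using b \<open>\<mu> > 0\<close> by real_asymp
  moreover have "\<rho> powr t = exp (- (q * t))" for t using rho by (simp add: powr_def q_def)
  ultimately show "((\<lambda>lam. (lam / \<mu>)\<^sup>2 * \<rho> powr (b * lam - 1)) \<longlongrightarrow> 0) at_top" by simp
qed (use mmsm_idle_nonneg in auto)

text \<open>The two hypotheses on \<open>\<sigma>\<close> are the Karush-Kuhn-Tucker conditions of minimising
  \<open>h * ((1 - \<sigma>) / \<gamma>) powr r + c / \<mu> * \<sigma>\<close> over \<open>\<sigma> \<ge> 0\<close>: capacity costs at least what it saves,
  with equality unless none is bought.\<close>
lemma staffing_cost_ge_fluid_cost:
  assumes pos: "lam > 0" "h > 0" "\<mu> > 0" "\<gamma> > 0" "r > 1" "\<sigma> < 1"
    and marginal_le: "h * r * ((1 - \<sigma>) / \<gamma>) powr (r - 1) / \<gamma> \<le> c / \<mu>"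
    and slackness: "\<sigma> = 0 \<or> h * r * ((1 - \<sigma>) / \<gamma>) powr (r - 1) / \<gamma> = c / \<mu>"
  shows "lam * (h * ((1 - \<sigma>) / \<gamma>) powr r + c / \<mu> * \<sigma>) \<le> staffing_cost h c \<mu> \<gamma> r lam s"
proof -
  define a where "a = (1 - \<sigma>) / \<gamma>"
  define m where "m = h * r * a powr (r - 1) / \<gamma>"
  define x where "x = mmsm_EW lam \<mu> \<gamma> s"
  have a: "a > 0" using pos by (simp add: a_def)
  have "x - a = (\<sigma> - \<mu> * real s / lam) / \<gamma> + \<mu> / (\<gamma> * lam) * mmsm_idle lam \<mu> \<gamma> s"
    using pos by (simp add: x_def a_def mmsm_EW_eq field_simps)
  moreover have "\<mu> / (\<gamma> * lam) * mmsm_idle lam \<mu> \<gamma> s \<ge> 0"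
    using pos mmsm_idle_nonneg by (intro mult_nonneg_nonneg) auto
  ultimately have d: "(\<sigma> - \<mu> * real s / lam) / \<gamma> \<le> x - a" by linarith
  have "\<sigma> = 0 \<or> m = c / \<mu>" using slackness by (simp only: m_def a_def)
  then have "c / \<mu> * \<sigma> = m * \<sigma>" by auto
  then have "lam * (h * a powr r + c / \<mu> * \<sigma>) = lam * (h * a powr r + m * \<sigma>)" by (simp only:)
  also have "\<dots> = lam * (h * (a powr r + r * a powr (r - 1) * ((\<sigma> - \<mu> * real s / lam) / \<gamma>))) + m * (\<mu> * real s)"
    using pos by (simp add: m_def field_simps)
  \<comment> \<open>Two losses: the idle-server correction is dropped, and each server is charged only the
    marginal saving \<open>m\<close> instead of its price.\<close>
  also have "\<dots> \<le> lam * (h * (a powr r + r * a powr (r - 1) * (x - a))) + c / \<mu> * (\<mu> * real s)"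
    using pos d marginal_le by (intro add_mono mult_left_mono mult_right_mono) (auto simp: m_def a_def)
  also have "\<dots> \<le> lam * (h * x powr r) + c / \<mu> * (\<mu> * real s)"
    using pos a by (intro add_right_mono mult_left_mono powr_ge_tangent) (auto simp: x_def mmsm_EW_nonneg)
  also have "\<dots> = staffing_cost h c \<mu> \<gamma> r lam s"
    using pos by (simp add: staffing_cost_def x_def)
  finally show ?thesis by (simp add: a_def)
qed

text \<open>Exact first-order balance makes the linear terms of waiting and staffing cost cancel, which
  leaves \<open>lam\<close> times the square of an \<open>o(1 / sqrt lam)\<close> deviation, plus a multiple of the
  mean number of idle servers.\<close>
lemma staffing_cost_minus_fluid_cost_tendsto_0:
  assumes pos: "h > 0" "\<mu> > 0" "\<gamma> > 0" "r > 1" "0 \<le> \<sigma>" "\<sigma> < 1"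
    and marginal: "h * r * ((1 - \<sigma>) / \<gamma>) powr (r - 1) / \<gamma> = c / \<mu>"
    and s: "(\<lambda>lam. real (s lam) - \<sigma> * (lam / \<mu>)) \<in> o[at_top](\<lambda>lam. sqrt lam)"
  shows "((\<lambda>lam. staffing_cost h c \<mu> \<gamma> r lam (s lam)
      - lam * (h * ((1 - \<sigma>) / \<gamma>) powr r + c / \<mu> * \<sigma>)) \<longlongrightarrow> 0) at_top"
proof -
  define a where "a = (1 - \<sigma>) / \<gamma>"
  define I where "I = (\<lambda>lam. mmsm_idle lam \<mu> \<gamma> (s lam))"
  define x where "x = (\<lambda>lam. mmsm_EW lam \<mu> \<gamma> (s lam))"
  define dev where "dev = (\<lambda>lam. (real (s lam) - \<sigma> * (lam / \<mu>)) / sqrt lam)"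
  have a: "a > 0" using pos by (simp add: a_def)
  have dev: "(dev \<longlongrightarrow> 0) at_top" unfolding dev_def using s by (rule smalloD_tendsto)
  have rsqrt: "((\<lambda>lam::real. 1 / sqrt lam) \<longlongrightarrow> 0) at_top" by real_asymp
  have "((\<lambda>lam. \<sigma> + \<mu> * dev lam * (1 / sqrt lam)) \<longlongrightarrow> \<sigma> + \<mu> * 0 * 0) at_top"
    by (intro tendsto_intros dev rsqrt)
  moreover have "\<forall>\<^sub>F lam in at_top. \<sigma> + \<mu> * dev lam * (1 / sqrt lam) = \<mu> * real (s lam) / lam"
    using eventually_gt_at_top[of 0]
  proof eventually_elim
    case (elim lam)
    then have "dev lam * (1 / sqrt lam) = (real (s lam) - \<sigma> * (lam / \<mu>)) / lam" by (simp add: dev_def)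
    then have "\<mu> * dev lam * (1 / sqrt lam) = \<mu> * ((real (s lam) - \<sigma> * (lam / \<mu>)) / lam)"
      by (simp only: mult.assoc)
    also have "\<dots> = \<mu> * real (s lam) / lam - \<sigma>" using elim pos by (simp add: field_simps)
    finally show ?case by simp
  qed
  ultimately have "((\<lambda>lam. \<mu> * real (s lam) / lam) \<longlongrightarrow> \<sigma>) at_top"
    using Lim_transform_eventually by force
  then have I: "(I \<longlongrightarrow> 0) at_top" unfolding I_def using pos by (intro mmsm_idle_tendsto_0)
  \<comment> \<open>The deviation of the wait from its fluid value on the scale \<open>1 / sqrt lam\<close>.\<close>
  define y where "y = (\<lambda>lam. - (\<mu> / \<gamma>) * dev lam + \<mu> / \<gamma> * I lam * (1 / sqrt lam))"
  have "(y \<longlongrightarrow> - (\<mu> / \<gamma>) * 0 + \<mu> / \<gamma> * 0 * 0) at_top"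
    unfolding y_def by (intro tendsto_intros dev I rsqrt)
  then have y: "(y \<longlongrightarrow> 0) at_top" by simp
  have x_eq: "x lam = a + y lam * (1 / sqrt lam)" if "lam > 0" for lam
  proof -
    have "dev lam * (1 / sqrt lam) = (real (s lam) - \<sigma> * (lam / \<mu>)) / lam"
      "(1 / sqrt lam) * (1 / sqrt lam) = 1 / lam" using that by (simp_all add: dev_def)
    then have y_eq: "y lam * (1 / sqrt lam) = - (\<mu> / \<gamma>) * ((real (s lam) - \<sigma> * (lam / \<mu>)) / lam) + \<mu> / \<gamma> * I lam * (1 / lam)"
      by (simp only: y_def distrib_right mult.assoc)
    show ?thesis unfolding y_eq using that pos by (simp add: x_def I_def a_def mmsm_EW_eq field_simps)
  qed
  have "((\<lambda>lam. a + y lam * (1 / sqrt lam)) \<longlongrightarrow> a + 0 * 0) at_top"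
    by (intro tendsto_intros y rsqrt)
  moreover have "\<forall>\<^sub>F lam in at_top. a + y lam * (1 / sqrt lam) = x lam"
    using eventually_gt_at_top[of 0] by eventually_elim (simp only: x_eq)
  ultimately have x: "(x \<longlongrightarrow> a) at_top"
    using Lim_transform_eventually by force
  \<comment> \<open>Caratheodory's form of the derivative supplies a factor \<open>g\<close> that converges as
    \<open>x lam\<close> tends to \<open>a\<close>; this bounds the change of the slope of \<open>t powr r\<close> between the two
    points by a multiple of their distance.\<close>
  have "((\<lambda>t. t powr (r - 1)) has_real_derivative (r - 1) * a powr (r - 1 - 1)) (at a)"
    using a by (intro has_real_derivative_powr)
  then obtain g where g: "\<And>z. z powr (r - 1) - a powr (r - 1) = g z * (z - a)" and "isCont g a"
    by (auto simp: CARAT_DERIV)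
  then have gx: "((\<lambda>lam. g (x lam)) \<longlongrightarrow> g a) at_top" using x isCont_tendsto_compose by blast
  define B where "B = (\<lambda>lam. h * r * g (x lam) * (y lam)\<^sup>2 + h * r * a powr (r - 1) * \<mu> / \<gamma> * I lam)"
  have "(B \<longlongrightarrow> h * r * g a * 0\<^sup>2 + h * r * a powr (r - 1) * \<mu> / \<gamma> * 0) at_top"
    unfolding B_def by (intro tendsto_intros gx y I)
  then have B: "(B \<longlongrightarrow> 0) at_top" by simp
  have "\<forall>\<^sub>F lam in at_top. x lam > 0" using order_tendstoD(1)[OF x a] .
  then have "\<forall>\<^sub>F lam in at_top. staffing_cost h c \<mu> \<gamma> r lam (s lam)
      - lam * (h * a powr r + c / \<mu> * \<sigma>) \<le> B lam"
    using eventually_gt_at_top[of 0]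
  proof eventually_elim
    case (elim lam)
    define d where "d = x lam - a"
    have d: "d = y lam * (1 / sqrt lam)" using x_eq elim by (simp add: d_def)
    have d2: "lam * d\<^sup>2 = (y lam)\<^sup>2" using elim by (simp add: d power_mult_distrib power_divide)
    have s_eq: "\<mu> * real (s lam) = lam * \<sigma> + \<mu> * I lam - lam * \<gamma> * d"
      using elim pos by (simp add: d_def x_def I_def a_def mmsm_EW_eq field_simps)
    have c_eq: "c = h * r * a powr (r - 1) / \<gamma> * \<mu>" using marginal pos by (simp add: a_def field_simps)
    \<comment> \<open>The tangent at \<open>x lam\<close>, evaluated at \<open>a\<close>, bounds \<open>x lam powr r\<close> from above.\<close>
    have "a powr r \<ge> x lam powr r + r * x lam powr (r - 1) * (a - x lam)"
      using pos elim a by (intro powr_ge_tangent) auto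
    then have "x lam powr r \<le> a powr r + r * x lam powr (r - 1) * d" by (simp add: d_def algebra_simps)
    also have "x lam powr (r - 1) = a powr (r - 1) + g (x lam) * d" using g[of "x lam"] by (simp add: d_def)
    finally have "h * lam * x lam powr r \<le> h * lam * (a powr r + r * (a powr (r - 1) + g (x lam) * d) * d)"
      using pos elim by (intro mult_left_mono) auto
    also have "\<dots> = h * lam * (a powr r + r * a powr (r - 1) * d) + h * r * g (x lam) * (lam * d\<^sup>2)"
      by (simp add: algebra_simps power2_eq_square)
    finally have "h * lam * x lam powr r \<le> h * lam * (a powr r + r * a powr (r - 1) * d) + h * r * g (x lam) * (y lam)\<^sup>2"
      by (simp only: d2)
    moreover have "c * real (s lam) = h * r * a powr (r - 1) / \<gamma> * (lam * \<sigma> + \<mu> * I lam - lam * \<gamma> * d)"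
      unfolding s_eq[symmetric] c_eq by simp
    moreover have "c / \<mu> = h * r * a powr (r - 1) / \<gamma>" using marginal by (simp add: a_def)
    moreover have "h * r * a powr (r - 1) / \<gamma> * (lam * \<sigma> + \<mu> * I lam - lam * \<gamma> * d)
       = lam * (h * r * a powr (r - 1) / \<gamma> * \<sigma>) + h * r * a powr (r - 1) * \<mu> / \<gamma> * I lam
         - h * lam * (r * a powr (r - 1) * d)"
      using pos by (simp add: field_simps)
    ultimately show ?case unfolding staffing_cost_def x_def[symmetric] B_def
      by (simp add: x_def algebra_simps)
  qed
  moreover have "\<forall>\<^sub>F lam in at_top. 0 \<le> staffing_cost h c \<mu> \<gamma> r lam (s lam) - lam * (h * a powr r + c / \<mu> * \<sigma>)"
    using eventually_gt_at_top[of 0]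
  proof eventually_elim
    case (elim lam)
    then show ?case
      using staffing_cost_ge_fluid_cost[of lam h \<mu> \<gamma> r \<sigma> c "s lam"] pos marginal by (simp add: a_def)
  qed
  ultimately show ?thesis
    unfolding a_def[symmetric] by (intro tendsto_sandwich[OF _ _ tendsto_const B])
qed

text \<open>\<open>sigma_star\<close> solves the first-order condition of the fluid problem if the solution is
  nonnegative; otherwise even the first server, which saves the most, costs more than it saves.\<close>
lemma sigma_star_optimality:
  assumes pos: "h > 0" "c > 0" "\<mu> > 0" "\<gamma> > 0" "r > 1"
  defines "\<sigma> \<equiv> sigma_star h c \<mu> \<gamma> r"
  shows "0 \<le> \<sigma>" "\<sigma> < 1"
    and "c * \<gamma> powr r \<le> h * r * \<mu> \<Longrightarrow> h * r * ((1 - \<sigma>) / \<gamma>) powr (r - 1) / \<gamma> = c / \<mu>"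
    and "c * \<gamma> powr r > h * r * \<mu> \<Longrightarrow> \<sigma> = 0"
    and "c * \<gamma> powr r > h * r * \<mu> \<Longrightarrow> h * r * (1 / \<gamma>) powr (r - 1) / \<gamma> \<le> c / \<mu>"
proof -
  define t where "t = c * \<gamma> powr r / (h * r * \<mu>)"
  have t: "t > 0" using pos by (simp add: t_def)
  have \<sigma>: "\<sigma> = max (1 - t powr (1 / (r - 1))) 0" by (simp add: \<sigma>_def sigma_star_def t_def)
  have split: "\<gamma> powr r = \<gamma> powr (r - 1) * \<gamma>" using pos by (simp add: powr_diff)
  show "0 \<le> \<sigma>" "\<sigma> < 1" using t by (simp_all add: \<sigma>)
  show "h * r * ((1 - \<sigma>) / \<gamma>) powr (r - 1) / \<gamma> = c / \<mu>" if "c * \<gamma> powr r \<le> h * r * \<mu>"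
  proof -
    have "t \<le> 1" using that pos by (simp add: t_def)
    then have "t powr (1 / (r - 1)) \<le> 1 powr (1 / (r - 1))" using t pos by (intro powr_mono2) auto
    then have "1 - \<sigma> = t powr (1 / (r - 1))" by (simp add: \<sigma>)
    then have "(1 - \<sigma>) powr (r - 1) = t" using t pos by (simp add: powr_powr)
    then have "((1 - \<sigma>) / \<gamma>) powr (r - 1) = t / \<gamma> powr (r - 1)"
      using pos \<open>\<sigma> < 1\<close> by (simp add: powr_divide)
    then show ?thesis using pos by (simp add: t_def split)
  qed
  assume big: "c * \<gamma> powr r > h * r * \<mu>"
  then have "t > 1" using pos by (simp add: t_def)
  then have "t powr (1 / (r - 1)) \<ge> 1 powr (1 / (r - 1))" using pos by (intro powr_mono2) auto
  then show "\<sigma> = 0" by (simp add: \<sigma>)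
  have "h * r * (1 / \<gamma>) powr (r - 1) / \<gamma> = h * r / \<gamma> powr r"
    using pos by (simp add: powr_divide split)
  also have "\<dots> \<le> c / \<mu>" using big pos by (simp add: field_simps)
  finally show "h * r * (1 / \<gamma>) powr (r - 1) / \<gamma> \<le> c / \<mu>" .
qed

section \<open>Asymptotic optimality of fluid staffing\<close>

theorem proposition5:
  fixes h c \<mu> \<gamma> r :: real and sbar :: "real \<Rightarrow> nat"
  assumes "h > 0" and "c > 0" and "\<mu> > 0" and "\<gamma> > 0" and "r > 1"
    and prescription:
      "(\<lambda>lam. real (sbar lam) - sigma_star h c \<mu> \<gamma> r * (lam / \<mu>)) \<in> o[at_top](\<lambda>lam. sqrt lam)"
    and no_staffing:
      "c * \<gamma> powr r > h * r * \<mu> \<Longrightarrow> \<forall>\<^sub>F lam in at_top. sbar lam = 0"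
  shows "sigma_star h c \<mu> \<gamma> r < 1 \<and>
    ((\<lambda>lam. staffing_cost h c \<mu> \<gamma> r lam (sbar lam) - optimal_cost h c \<mu> \<gamma> r lam)
       \<longlongrightarrow> 0) at_top"
proof
  note pos = assms(1-5)
  define \<sigma> where "\<sigma> = sigma_star h c \<mu> \<gamma> r"
  note \<sigma> = sigma_star_optimality[OF pos, folded \<sigma>_def]
  define F where "F = (\<lambda>lam. lam * (h * ((1 - \<sigma>) / \<gamma>) powr r + c / \<mu> * \<sigma>))"
  show "sigma_star h c \<mu> \<gamma> r < 1" using \<sigma>(2) by (simp add: \<sigma>_def)
  have F_le: "F lam \<le> staffing_cost h c \<mu> \<gamma> r lam s" if "lam > 0" for lam s
  proof (cases "c * \<gamma> powr r \<le> h * r * \<mu>")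
    case True
    then show ?thesis unfolding F_def using \<sigma> pos that by (intro staffing_cost_ge_fluid_cost) auto
  next
    case False
    then show ?thesis unfolding F_def using \<sigma> pos that by (intro staffing_cost_ge_fluid_cost) auto
  qed
  have upper: "((\<lambda>lam. staffing_cost h c \<mu> \<gamma> r lam (sbar lam) - F lam) \<longlongrightarrow> 0) at_top"
  proof (cases "c * \<gamma> powr r \<le> h * r * \<mu>")
    case True
    then show ?thesis unfolding F_def using \<sigma> pos prescription
      by (intro staffing_cost_minus_fluid_cost_tendsto_0) (auto simp: \<sigma>_def)
  next
    case False
    then have "\<forall>\<^sub>F lam in at_top. sbar lam = 0" using no_staffing by simp
    then have "\<forall>\<^sub>F lam in at_top. 0 = staffing_cost h c \<mu> \<gamma> r lam (sbar lam) - F lam"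
      using eventually_gt_at_top[of 0]
    proof eventually_elim
      case (elim lam)
      then show ?case using \<sigma>(4) False pos by (simp add: F_def staffing_cost_def mmsm_EW_eq)
    qed
    with tendsto_const show ?thesis by (rule Lim_transform_eventually)
  qed
  show "((\<lambda>lam. staffing_cost h c \<mu> \<gamma> r lam (sbar lam) - optimal_cost h c \<mu> \<gamma> r lam) \<longlongrightarrow> 0) at_top"
  proof (rule tendsto_sandwich[OF _ _ tendsto_const upper])
    show "\<forall>\<^sub>F lam in at_top. 0 \<le> staffing_cost h c \<mu> \<gamma> r lam (sbar lam) - optimal_cost h c \<mu> \<gamma> r lam"
      using eventually_gt_at_top[of 0]
    proof eventually_elim
      case (elim lam)
      have "bdd_below (range (staffing_cost h c \<mu> \<gamma> r lam))"
        using F_le[OF elim] by (rule bdd_belowI2)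
      then show ?case unfolding optimal_cost_def by (simp add: cINF_lower)
    qed
    show "\<forall>\<^sub>F lam in at_top. staffing_cost h c \<mu> \<gamma> r lam (sbar lam) - optimal_cost h c \<mu> \<gamma> r lam
        \<le> staffing_cost h c \<mu> \<gamma> r lam (sbar lam) - F lam"
      using eventually_gt_at_top[of 0]
    proof eventually_elim
      case (elim lam)
      have "F lam \<le> optimal_cost h c \<mu> \<gamma> r lam"
        unfolding optimal_cost_def using F_le[OF elim] by (intro cINF_greatest) auto
      then show ?case by simp
    qed
  qed
qed

end
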